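(* Let $n\ge 1$ and let $A_1,A_2$ be alternating sign triangles of size $n$ (as defined in the context). Then $A_1$ can be obtained from $A_2$ by a finite sequence of operations, each of which adds to or subtracts from the current array one of the three sub-triangle patterns $P_1^{(r,c)},P_2^{(r,c)},P_3^{(r,c)}$ (for some admissible position $(r,c)$) defined in the context.
   Context: Fix an integer $n\ge 1$. Let $V_n=\{(i,j)\in\mathbb{Z}^2 : |i|+|j|\le n,\ j\le 0,\ i+j\equiv n \pmod 2\}$. Two points of $V_n$ are joined by a lattice edge if they differ by $(\pm 2,0)$ or by $(\pm1,\pm1)$. A simplified grove of size $n$ is a graph $G$ with vertex set $V_n$ whose edges are lattice edges, such that (acyclicity) $G$ has no cycle, and (connectivity) each connected component of $G$ contains exactly one of the following sets of boundary vertices and each of these sets is contained in some component: the singletons $\{(-n,0)\},\{(n,0)\},\{(0,-n)\}$; the west pairs $\{(-i,0),(\frac{-n-i}{2},\frac{-n+i}{2})\}$ for $0<i<n$, $i\equiv n \pmod 2$; the east pairs $\{(i,0),(\frac{n+i}{2},\frac{-n+i}{2})\}$ for $0<i<n$, $i\equiv n\pmod 2$; the south pairs $\{(-n+i,-i),(n-i,-i)\}$ for $\frac n2<i<n$; and, if $n$ is even, the middle triplet $\{(0,0),(-\frac n2,-\frac n2),(\frac n2,-\frac n2)\}$. For $1\le r\le n$ and $1\le c\le n+1-r$ put $a_{r,c}=2c-2-n+r$ and let $T_{r,c}$ be the (downward) unit triangle with vertices $(a_{r,c},-r)$, $(a_{r,c}-1,-r+1)$, $(a_{r,c}+1,-r+1)$;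 its three sides are lattice edges. For a simplified grove $G$ of size $n$, define the triangular array $A_G$ with entries $A_G(r,c)=1-e_{r,c}$, where $e_{r,c}$ is the number of sides of $T_{r,c}$ that are edges of $G$ ($1\le r\le n$, $1\le c\le n+1-r$). An alternating sign triangle of size $n$ is an array of the form $A_G$ for some simplified grove $G$ of size $n$. (Row $r$ has $n+1-r$ entries; entry $(r+1,c)$ is drawn below and between entries $(r,c)$ and $(r,c+1)$.) For $1\le r\le n-1$ and $1\le c\le n-r$, the sub-triangle patterns at position $(r,c)$ are the arrays supported on the entries $(r,c),(r,c+1),(r+1,c)$ given by: $P_1^{(r,c)}$: $-1$ at $(r,c)$, $1$ at $(r,c+1)$, $0$ at $(r+1,c)$; $P_2^{(r,c)}$: $1$ at $(r,c)$, $0$ at $(r,c+1)$, $-1$ at $(r+1,c)$; $P_3^{(r,c)}$: $0$ at $(r,c)$, $-1$ at $(r,c+1)$, $1$ at $(r+1,c)$ (and $0$ at all other entries). Adding/subtracting a pattern means entrywise addition/subtraction. *)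

theory Defs
  imports "HOL-Number_Theory.Cong"
begin

type_synonym vertex = "int \<times> int"

definition grove_vertices :: "nat \<Rightarrow> vertex set" where
  "grove_vertices n = {(i, j). \<bar>i\<bar> + \<bar>j\<bar> \<le> int n \<and> j \<le> 0 \<and> [i + j = int n] (mod 2)}"

definition lattice_edges :: "nat \<Rightarrow> vertex set set" where
  "lattice_edges n = {{p, q} | p q. p \<in> grove_vertices n \<and> q \<in> grove_vertices n \<and>
     (fst q - fst p, snd q - snd p) \<in> {(2, 0), (-2, 0), (1, 1), (1, -1), (-1, 1), (-1, -1)}}"

text \<open>
  A simple graph is given by its set of edges, each edge being a two-element set of vertices;
  the vertex set is supplied separately where it matters.
\<close>

definition is_cycle :: "'v set set \<Rightarrow> 'v list \<Rightarrow> bool" where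
  "is_cycle E vs \<longleftrightarrow> length vs \<ge> 3 \<and> distinct vs \<and>
     (\<forall>k < length vs. {vs ! k, vs ! ((k + 1) mod length vs)} \<in> E)"

definition components :: "'v set \<Rightarrow> 'v set set \<Rightarrow> 'v set set" where
  "components V E = V // {(u, v). {u, v} \<in> E}\<^sup>*"

text \<open>The divisions by 2 below are exact, since \<open>i\<close> and \<open>n\<close> have the same parity.\<close>

definition west_pairs :: "int \<Rightarrow> vertex set set" where
  "west_pairs n = {{(- i, 0), ((- n - i) div 2, (- n + i) div 2)} | i.
     0 < i \<and> i < n \<and> [i = n] (mod 2)}"

definition east_pairs :: "int \<Rightarrow> vertex set set" where
  "east_pairs n = {{(i, 0), ((n + i) div 2, (- n + i) div 2)} | i.
     0 < i \<and> i < n \<and> [i = n] (mod 2)}"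

definition south_pairs :: "int \<Rightarrow> vertex set set" where
  "south_pairs n = {{(- n + i, - i), (n - i, - i)} | i. n < 2 * i \<and> i < n}"

definition middle_triplet :: "int \<Rightarrow> vertex set set" where
  "middle_triplet n =
     (if even n then {{(0, 0), (- (n div 2), - (n div 2)), (n div 2, - (n div 2))}} else {})"

definition boundary_sets :: "nat \<Rightarrow> vertex set set" where
  "boundary_sets n =
     {{(- int n, 0)}, {(int n, 0)}, {(0, - int n)}} \<union>
     west_pairs (int n) \<union> east_pairs (int n) \<union> south_pairs (int n) \<union> middle_triplet (int n)"

definition simplified_grove :: "nat \<Rightarrow> vertex set set \<Rightarrow> bool" where
  "simplified_grove n G \<longleftrightarrow>
     G \<subseteq> lattice_edges n \<and>
     (\<nexists>vs. is_cycle G vs) \<and>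
     (\<forall>C \<in> components (grove_vertices n) G. \<exists>!S. S \<in> boundary_sets n \<and> S \<subseteq> C) \<and>
     (\<forall>S \<in> boundary_sets n. \<exists>C \<in> components (grove_vertices n) G. S \<subseteq> C)"

definition triangle_sides :: "nat \<Rightarrow> nat \<Rightarrow> nat \<Rightarrow> vertex set set" where
  "triangle_sides n r c =
     (let a = 2 * int c - 2 - int n + int r;
          x = (a, - int r); y = (a - 1, - int r + 1); z = (a + 1, - int r + 1)
      in {{x, y}, {x, z}, {y, z}})"

text \<open>
  A triangular array of size \<open>n\<close> is a function of the row and column index that is 0 outside the
  range \<open>1 \<le> r \<le> n\<close>, \<open>1 \<le> c \<le> n + 1 - r\<close>, so that equality of arrays is equality of functions.
\<close>

type_synonym array = "nat \<Rightarrow> nat \<Rightarrow> int"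

definition grove_array :: "nat \<Rightarrow> vertex set set \<Rightarrow> array" where
  "grove_array n G = (\<lambda>r c.
     if 1 \<le> r \<and> r \<le> n \<and> 1 \<le> c \<and> c \<le> n + 1 - r
     then 1 - int (card (triangle_sides n r c \<inter> G)) else 0)"

definition alternating_sign_triangle :: "nat \<Rightarrow> array \<Rightarrow> bool" where
  "alternating_sign_triangle n A \<longleftrightarrow> (\<exists>G. simplified_grove n G \<and> A = grove_array n G)"

definition sub_triangle :: "int \<Rightarrow> int \<Rightarrow> int \<Rightarrow> nat \<Rightarrow> nat \<Rightarrow> array" where
  "sub_triangle x y z r c = (\<lambda>r' c'.
     if (r', c') = (r, c) then x
     else if (r', c') = (r, c + 1) then y
     else if (r', c') = (r + 1, c) then z
     else 0)"

definition pattern1 :: "nat \<Rightarrow> nat \<Rightarrow> array" where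
  "pattern1 = sub_triangle (-1) 1 0"

definition pattern2 :: "nat \<Rightarrow> nat \<Rightarrow> array" where
  "pattern2 = sub_triangle 1 0 (-1)"

definition pattern3 :: "nat \<Rightarrow> nat \<Rightarrow> array" where
  "pattern3 = sub_triangle 0 (-1) 1"

text \<open>Neither array is required to be an alternating sign triangle.\<close>

definition pattern_step :: "nat \<Rightarrow> array \<Rightarrow> array \<Rightarrow> bool" where
  "pattern_step n A B \<longleftrightarrow>
     (\<exists>r c P. 1 \<le> r \<and> r \<le> n - 1 \<and> 1 \<le> c \<and> c \<le> n - r \<and>
        P \<in> {pattern1 r c, pattern2 r c, pattern3 r c} \<and>
        (B = (\<lambda>r' c'. A r' c' + P r' c') \<or> B = (\<lambda>r' c'. A r' c' - P r' c')))"

end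

theory Submission
  imports Defs
begin

text \<open>
  The three patterns at a position are differences of unit arrays at neighbouring entries, so they
  generate all integer arrays with vanishing entry sum. It remains to see that the entry sum of
  \<open>A\<^sub>G\<close> does not depend on \<open>G\<close>: every lattice edge is a side of exactly one of the triangles
  \<open>T\<^bsub>r,c\<^esub>\<close>, so the sum is the number of triangles minus the number of edges of the forest \<open>G\<close>, and
  the latter is the number of vertices minus the number of components, i.e. of boundary sets.
\<close>

subsection \<open>Counting the edges of a forest\<close>

lemma equiv_connected: "equiv UNIV ({(u, v). {u, v} \<in> E}\<^sup>*)"
  by (intro equivI refl_rtrancl sym_rtrancl trans_rtrancl) (auto simp: insert_commute intro: symI)

text \<open>Each step prepends a vertex to a simple path. If the vertex already lies on the path,
  everything before its occurrence is cut off instead, so no repetition arises.\<close>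

lemma distinct_path_if_connected:
  assumes "(u, v) \<in> {(u, v). {u, v} \<in> E}\<^sup>*"
  obtains vs where "vs \<noteq> []" "hd vs = u" "last vs = v" "distinct vs"
    "successively (\<lambda>x y. {x, y} \<in> E) vs"
proof -
  have "\<exists>vs. vs \<noteq> [] \<and> hd vs = u \<and> last vs = v \<and> distinct vs \<and>
      successively (\<lambda>x y. {x, y} \<in> E) vs"
    using assms
  proof (induction rule: converse_rtrancl_induct)
    case base
    show ?case by (rule exI[of _ "[v]"]) simp
  next
    case (step u w)
    then obtain vs where vs: "vs \<noteq> []" "hd vs = w" "last vs = v" "distinct vs"
      "successively (\<lambda>x y. {x, y} \<in> E) vs" by blast
    show ?case
    proof (cases "u \<in> set vs")
      case True
      then obtain xs ys where "vs = xs @ u # ys" by (meson split_list)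
      with vs show ?thesis
        by (intro exI[of _ "u # ys"]) (auto simp: successively_append_iff)
    next
      case False
      with vs step.hyps show ?thesis
        by (intro exI[of _ "u # vs"]) (auto simp: successively_Cons)
    qed
  qed
  then show thesis using that by blast
qed

text \<open>The successor index wraps around only at the last vertex, and there the required edge is
  the added one; all other edges come from the path.\<close>

lemma is_cycle_if_closed_path:
  assumes path: "successively (\<lambda>x y. {x, y} \<in> E) vs" and "distinct vs" "length vs \<ge> 3"
  shows "is_cycle (insert {hd vs, last vs} E) vs"
  unfolding is_cycle_def
proof (intro conjI allI impI)
  fix k assume k: "k < length vs"
  have ne: "vs \<noteq> []" using assms(3) by auto
  show "{vs ! k, vs ! ((k + 1) mod length vs)} \<in> insert {hd vs, last vs} E"
  proof (cases "Suc k = length vs")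
    case True
    then have "k = length vs - 1" by simp
    then show ?thesis using True ne by (simp add: hd_conv_nth last_conv_nth insert_commute)
  next
    case False
    then have "Suc k < length vs" using k by simp
    then show ?thesis using path by (auto simp: successively_conv_nth)
  qed
qed (use assms in auto)

text \<open>A simple path from \<open>u\<close> to \<open>v\<close> in \<open>E\<close> would close
  up to a cycle through the new edge.\<close>

lemma not_connected_if_acyclic_insert:
  assumes "u \<noteq> v" "{u, v} \<notin> E" "\<nexists>vs. is_cycle (insert {u, v} E) vs"
  shows "(u, v) \<notin> {(u, v). {u, v} \<in> E}\<^sup>*"
proof
  assume "(u, v) \<in> {(u, v). {u, v} \<in> E}\<^sup>*"
  then obtain vs where vs: "vs \<noteq> []" "hd vs = u" "last vs = v" "distinct vs"
    "successively (\<lambda>x y. {x, y} \<in> E) vs" by (rule distinct_path_if_connected)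
  \<comment> \<open>A path with one vertex would give \<open>u = v\<close>, and one with two
    vertices would consist of the edge \<open>{u, v}\<close> itself, which is not in
    \<open>E\<close>.\<close>
  have "length vs \<ge> 3"
  proof (rule ccontr)
    assume "\<not> length vs \<ge> 3"
    then consider x where "vs = [x]" | x y where "vs = [x, y]"
      using vs(1) by (cases vs; cases "tl vs"; cases "tl (tl vs)") auto
    then show False using vs assms(1,2) by cases auto
  qed
  then have "is_cycle (insert {u, v} E) vs" using vs is_cycle_if_closed_path by metis
  then show False using assms(3) by blast
qed

text \<open>A walk needs the new edge at most once, since a second crossing can be cut out. The
  three disjuncts are: no crossing, a crossing from \<open>u\<close> to \<open>v\<close>, a crossing
  from \<open>v\<close> to \<open>u\<close>.\<close>

lemma connected_insert_edge:
  fixes E u v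
  defines "R \<equiv> {(x, y). {x, y} \<in> E}\<^sup>*"
  shows "(x, y) \<in> {(x, y). {x, y} \<in> insert {u, v} E}\<^sup>* \<longleftrightarrow>
    (x, y) \<in> R \<or> (x, u) \<in> R \<and> (v, y) \<in> R \<or> (x, v) \<in> R \<and> (u, y) \<in> R"
    (is "(x, y) \<in> ?S\<^sup>* \<longleftrightarrow> ?rhs x y")
proof
  have trans: "(a, c) \<in> R" if "(a, b) \<in> R" "(b, c) \<in> R" for a b c
    using that unfolding R_def by (rule rtrancl_trans)
  have refl: "(a, a) \<in> R" for a unfolding R_def by simp
  have sym: "(b, a) \<in> R" if "(a, b) \<in> R" for a b
    using that equiv_connected[of E] unfolding R_def by (meson equiv_def symD)
  assume "(x, y) \<in> ?S\<^sup>*"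
  then show "?rhs x y"
  proof (induction rule: rtrancl_induct)
    case base
    show ?case using refl by simp
  next
    case (step y z)
    from step.hyps(2) consider "(y, z) \<in> R" | "y = u" "z = v" | "y = v" "z = u"
      unfolding R_def by (auto simp: doubleton_eq_iff)
    then show ?case using step.IH by cases (blast intro: trans refl sym)+
  qed
next
  have sub: "(a, b) \<in> ?S\<^sup>*" if "(a, b) \<in> R" for a b
    using that unfolding R_def by (rule rtrancl_mono[THEN subsetD, rotated]) auto
  have uv: "(u, v) \<in> ?S\<^sup>*" "(v, u) \<in> ?S\<^sup>*"
    by (auto intro!: r_into_rtrancl simp: insert_commute)
  assume "?rhs x y"
  then show "(x, y) \<in> ?S\<^sup>*"
    by (elim disjE conjE) (rule sub rtrancl_trans[OF sub rtrancl_trans[OF uv(1) sub]]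
        rtrancl_trans[OF sub rtrancl_trans[OF uv(2) sub]]; assumption)+
qed

text \<open>The new edge merges the classes of \<open>u\<close> and \<open>v\<close>, which differ
  by \<open>nc\<close>, and leaves all other classes as they are.\<close>

lemma card_components_insert_edge:
  assumes fin: "finite V" and V: "u \<in> V" "v \<in> V"
    and nc: "(u, v) \<notin> {(u, v). {u, v} \<in> E}\<^sup>*"
  shows "Suc (card (components V (insert {u, v} E))) = card (components V E)"
proof -
  define R where "R = {(x, y). {x, y} \<in> E}\<^sup>*"
  define S where "S = {(x, y). {x, y} \<in> insert {u, v} E}\<^sup>*"
  have eqR: "equiv UNIV R" unfolding R_def by (rule equiv_connected)
  have S_iff: "(x, y) \<in> S \<longleftrightarrow>
      (x, y) \<in> R \<or> (x, u) \<in> R \<and> (v, y) \<in> R \<or> (x, v) \<in> R \<and> (u, y) \<in> R" for x y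
    unfolding S_def R_def by (rule connected_insert_edge)
  have sym: "(a, b) \<in> R \<longleftrightarrow> (b, a) \<in> R" for a b using eqR by (meson equiv_def symD)
  have trans: "(a, c) \<in> R" if "(a, b) \<in> R" "(b, c) \<in> R" for a b c
    using eqR that by (meson equiv_def transD)
  have refl: "(a, a) \<in> R" for a unfolding R_def by simp
  have class_eq: "R `` {x} = R `` {y} \<longleftrightarrow> (x, y) \<in> R" for x y
    using eq_equiv_class_iff[OF eqR] by simp
  have new: "S `` {x} = R `` {u} \<union> R `` {v}" if "(x, u) \<in> R \<or> (x, v) \<in> R" for x
    using that by (auto simp: S_iff) (metis sym trans)+
  have old: "S `` {x} = R `` {x}" if "\<not> ((x, u) \<in> R \<or> (x, v) \<in> R)" for x
    using that by (auto simp: S_iff)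
  \<comment> \<open>\<open>Q\<close> collects the components untouched by the new edge. Before the
    insertion two classes are added to it, afterwards only their union.\<close>
  define Q where "Q = components V E - {R `` {u}, R `` {v}}"
  have Q: "Q = (\<lambda>x. R `` {x}) ` {x \<in> V. \<not> ((x, u) \<in> R \<or> (x, v) \<in> R)}"
  proof -
    have "Q = (\<lambda>x. R `` {x}) ` V - {R `` {u}, R `` {v}}"
      unfolding Q_def components_def R_def quotient_def by blast
    also have "\<dots> = (\<lambda>x. R `` {x}) ` {x \<in> V. \<not> (R `` {x} = R `` {u} \<or> R `` {x} = R `` {v})}"
      by blast
    finally show ?thesis unfolding class_eq .
  qed
  have "components V (insert {u, v} E) = (\<lambda>x. S `` {x}) ` V"
    unfolding components_def S_def quotient_def by auto
  also have "\<dots> = (\<lambda>x. S `` {x}) ` ({x \<in> V. (x, u) \<in> R \<or> (x, v) \<in> R} \<union>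
      {x \<in> V. \<not> ((x, u) \<in> R \<or> (x, v) \<in> R)})"
    by (rule arg_cong[where f = "image _"]) auto
  also have "\<dots> = insert (R `` {u} \<union> R `` {v}) Q"
  proof -
    have "(\<lambda>x. S `` {x}) ` {x \<in> V. (x, u) \<in> R \<or> (x, v) \<in> R} =
        (\<lambda>x. R `` {u} \<union> R `` {v}) ` {x \<in> V. (x, u) \<in> R \<or> (x, v) \<in> R}"
      by (rule image_cong) (use new in auto)
    also have "\<dots> = {R `` {u} \<union> R `` {v}}" using V refl by auto
    finally have 1: "(\<lambda>x. S `` {x}) ` {x \<in> V. (x, u) \<in> R \<or> (x, v) \<in> R} =
        {R `` {u} \<union> R `` {v}}" .
    have 2: "(\<lambda>x. S `` {x}) ` {x \<in> V. \<not> ((x, u) \<in> R \<or> (x, v) \<in> R)} = Q"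
      unfolding Q by (rule image_cong) (use old in auto)
    show ?thesis unfolding image_Un 1 2 by simp
  qed
  finally have comp: "components V (insert {u, v} E) = insert (R `` {u} \<union> R `` {v}) Q" .
  have finC: "finite (components V E)"
    unfolding components_def quotient_def using fin by simp
  have "R `` {u} \<union> R `` {v} \<notin> Q"
  proof
    assume "R `` {u} \<union> R `` {v} \<in> Q"
    then obtain x where "R `` {u} \<union> R `` {v} = R `` {x}" "(x, u) \<notin> R" unfolding Q by auto
    then show False using refl by blast
  qed
  then have "card (components V (insert {u, v} E)) = Suc (card Q)"
    using comp finC by (simp add: Q_def)
  moreover have "card (components V E) = Suc (Suc (card Q))"
  proof -
    have "components V E = insert (R `` {u}) (insert (R `` {v}) Q)"
      using V by (auto simp: Q_def components_def R_def intro: quotientI)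
    then have "card (components V E) = card (insert (R `` {u}) (insert (R `` {v}) Q))"
      by (rule arg_cong)
    moreover have "R `` {u} \<noteq> R `` {v}" using nc class_eq unfolding R_def by simp
    moreover have "finite Q" "R `` {u} \<notin> Q" "R `` {v} \<notin> Q" using finC by (auto simp: Q_def)
    ultimately show ?thesis by simp
  qed
  ultimately show ?thesis by simp
qed

lemma is_cycle_mono: "is_cycle E vs \<Longrightarrow> E \<subseteq> F \<Longrightarrow> is_cycle F vs"
  unfolding is_cycle_def by blast

text \<open>Without edges every vertex is a component of its own. Each further edge of a forest
  joins two different components, so the sum of the two counts is preserved.\<close>

lemma card_edges_plus_card_components:
  assumes "finite V" "finite E" "\<And>e. e \<in> E \<Longrightarrow> \<exists>u\<in>V. \<exists>v\<in>V. u \<noteq> v \<and> e = {u, v}"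
    and "\<nexists>vs. is_cycle E vs"
  shows "card E + card (components V E) = card V"
  using assms(2,3,4)
proof (induction E rule: finite_induct)
  case empty
  have "components V {} = (\<lambda>x. {x}) ` V" by (auto simp: components_def quotient_def)
  then show ?case by (simp add: card_image)
next
  case (insert e E)
  obtain u v where uv: "u \<in> V" "v \<in> V" "u \<noteq> v" "e = {u, v}"
    using insert.prems(1)[OF insertI1] by blast
  have IH: "card E + card (components V E) = card V"
  proof (rule insert.IH)
    show "\<exists>u\<in>V. \<exists>v\<in>V. u \<noteq> v \<and> f = {u, v}" if "f \<in> E" for f
      using insert.prems(1) that by simp
    show "\<nexists>vs. is_cycle E vs"
      using insert.prems(2) is_cycle_mono[OF _ subset_insertI] by metis
  qed
  have "(u, v) \<notin> {(u, v). {u, v} \<in> E}\<^sup>*"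
    using insert.prems(2) insert.hyps(2) uv by (intro not_connected_if_acyclic_insert) auto
  then have "Suc (card (components V (insert e E))) = card (components V E)"
    unfolding uv(4) using uv assms(1) by (intro card_components_insert_edge) auto
  then show ?case using IH insert.hyps by simp
qed

subsection \<open>The entry sum of an alternating sign triangle\<close>

definition positions :: "nat \<Rightarrow> (nat \<times> nat) set" where
  "positions n = {(r, c). 1 \<le> r \<and> r \<le> n \<and> 1 \<le> c \<and> c \<le> n + 1 - r}"

lemma finite_positions: "finite (positions n)"
  by (rule finite_subset[of _ "{..n} \<times> {..n}"]) (auto simp: positions_def)

lemma finite_grove_vertices: "finite (grove_vertices n)"
  by (rule finite_subset[of _ "{- int n..int n} \<times> {- int n..int n}"])
    (auto simp: grove_vertices_def)

lemma finite_lattice_edges: "finite (lattice_edges n)"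
  by (rule finite_subset[of _ "Pow (grove_vertices n)"])
    (auto simp: finite_grove_vertices lattice_edges_def)

text \<open>All triangles point downward, so the direction of a side tells which of the three sides
  it is, and its endpoints then determine \<open>r\<close> and \<open>c\<close>.\<close>

lemma triangle_sides_disjoint:
  assumes "triangle_sides n r c \<inter> triangle_sides n r' c' \<noteq> {}"
  shows "r = r' \<and> c = c'"
  using assms unfolding triangle_sides_def Let_def by (auto simp: doubleton_eq_iff)

text \<open>The six allowed differences form three pairs of opposite vectors. Orienting the edge
  rightward or upward leaves one case for each side of a downward triangle.\<close>

lemma lattice_edge_orientation:
  assumes "e \<in> lattice_edges n"
  obtains i j i' j' where "e = {(i, j), (i', j')}"
    "(i, j) \<in> grove_vertices n" "(i', j') \<in> grove_vertices n"
    "(i', j') \<in> {(i + 2, j), (i + 1, j + 1), (i - 1, j + 1)}"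
proof -
  obtain i j i' j' where e: "e = {(i, j), (i', j')}"
    "(i, j) \<in> grove_vertices n" "(i', j') \<in> grove_vertices n"
    "(i' - i, j' - j) \<in> {(2, 0), (-2, 0), (1, 1), (1, -1), (-1, 1), (-1, -1)}"
  proof -
    obtain p q where "e = {p, q}" "p \<in> grove_vertices n" "q \<in> grove_vertices n"
      "(fst q - fst p, snd q - snd p) \<in> {(2, 0), (-2, 0), (1, 1), (1, -1), (-1, 1), (-1, -1)}"
      using assms unfolding lattice_edges_def by (elim CollectE exE conjE)
    then show thesis using that[of "fst p" "snd p" "fst q" "snd q"] by (simp only: prod.collapse)
  qed
  then have "(i', j') \<in> {(i + 2, j), (i + 1, j + 1), (i - 1, j + 1)} \<or>
      (i, j) \<in> {(i' + 2, j'), (i' + 1, j' + 1), (i' - 1, j' + 1)}" by auto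
  then show thesis
  proof
    assume "(i', j') \<in> {(i + 2, j), (i + 1, j + 1), (i - 1, j + 1)}"
    then show thesis by (rule that[OF e(1-3)])
  next
    assume "(i, j) \<in> {(i' + 2, j'), (i' + 1, j' + 1), (i' - 1, j' + 1)}"
    moreover have "e = {(i', j'), (i, j)}" using e(1) by (simp add: insert_commute)
    ultimately show thesis using that e(2,3) by blast
  qed
qed

lemma lattice_edge_endpoints:
  assumes "e \<in> lattice_edges n"
  shows "\<exists>u\<in>grove_vertices n. \<exists>v\<in>grove_vertices n. u \<noteq> v \<and> e = {u, v}"
proof -
  obtain i j i' j' where e: "e = {(i, j), (i', j')}"
    "(i, j) \<in> grove_vertices n" "(i', j') \<in> grove_vertices n"
    "(i', j') \<in> {(i + 2, j), (i + 1, j + 1), (i - 1, j + 1)}"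
    using assms by (rule lattice_edge_orientation)
  from e(4) have "(i, j) \<noteq> (i', j')" by auto
  with e(1-3) show ?thesis by blast
qed

text \<open>A horizontal edge is the top side of the triangle below it; a slanted edge starts at the
  bottom vertex of its triangle.\<close>

lemma lattice_edges_subset_triangle_sides:
  "lattice_edges n \<subseteq> (\<Union>(r, c) \<in> positions n. triangle_sides n r c)"
proof
  fix e assume "e \<in> lattice_edges n"
  then obtain i j i' j' where e: "e = {(i, j), (i', j')}"
    and V: "(i, j) \<in> grove_vertices n" "(i', j') \<in> grove_vertices n"
    and d: "(i', j') \<in> {(i + 2, j), (i + 1, j + 1), (i - 1, j + 1)}"
    by (rule lattice_edge_orientation)
  have "even (i + j - int n)" using V(1) by (simp add: grove_vertices_def cong_iff_dvd_diff)
  then obtain k where "i + j - int n = 2 * k" by (rule evenE)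
  then have k: "i + j = int n + 2 * k" by simp
  have b: "\<bar>i\<bar> + \<bar>j\<bar> \<le> int n" "j \<le> 0" "\<bar>i'\<bar> + \<bar>j'\<bar> \<le> int n" "j' \<le> 0"
    using V by (auto simp: grove_vertices_def)
  \<comment> \<open>The indices solve the coordinate equations of the triangle:
    \<open>(i, j)\<close> is the upper left vertex \<open>(a - 1, - r + 1)\<close> for a horizontal
    edge and the bottom vertex \<open>(a, - r)\<close> for a slanted one. In both cases
    \<open>2 * c = i + j + n + 2\<close>, hence the common formula for \<open>c\<close>.\<close>
  define r where "r = (if j' = j then nat (1 - j) else nat (- j))"
  define c where "c = nat (int n + k + 1)"
  have "(r, c) \<in> positions n \<and> e \<in> triangle_sides n r c"
  proof (cases "j' = j")
    case True
    then have i': "i' = i + 2" using d by auto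
    have r: "int r = 1 - j" and c: "int c = int n + k + 1"
      unfolding r_def c_def using True b k by auto
    \<comment> \<open>The triangle stays inside the array because the right endpoint
      \<open>(i + 2, j)\<close> also satisfies the bounds of the region.\<close>
    have "(r, c) \<in> positions n" unfolding positions_def using r c b k i' True by auto
    moreover have "e = {(2 * int c - 2 - int n + int r - 1, - int r + 1),
        (2 * int c - 2 - int n + int r + 1, - int r + 1)}"
      unfolding e r c using i' True k by auto
    ultimately show ?thesis unfolding triangle_sides_def Let_def by blast
  next
    case False
    then have d': "j' = j + 1" "i' = i + 1 \<or> i' = i - 1" using d by auto
    have r: "int r = - j" and c: "int c = int n + k + 1"
      unfolding r_def c_def using False b k by auto
    \<comment> \<open>Here \<open>r \<ge> 1\<close> comes from the upper endpoint:
      \<open>j + 1 \<le> 0\<close>.\<close>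
    have "(r, c) \<in> positions n" unfolding positions_def using r c b k d' by auto
    moreover have "e \<in> triangle_sides n r c"
      unfolding triangle_sides_def Let_def e r c using d' k by (auto simp: doubleton_eq_iff)
    ultimately show ?thesis by blast
  qed
  then show "e \<in> (\<Union>(r, c) \<in> positions n. triangle_sides n r c)" by blast
qed

text \<open>The side sets cover the lattice edges and are pairwise disjoint, so each edge of
  \<open>G\<close> is counted exactly once.\<close>

lemma sum_card_triangle_sides:
  assumes "G \<subseteq> lattice_edges n"
  shows "(\<Sum>(r, c) \<in> positions n. card (triangle_sides n r c \<inter> G)) = card G"
proof -
  have "G = (\<Union>p \<in> positions n. triangle_sides n (fst p) (snd p) \<inter> G)"
    using assms lattice_edges_subset_triangle_sides[of n] unfolding case_prod_unfold by blast
  then have "card G = card (\<Union>p \<in> positions n. triangle_sides n (fst p) (snd p) \<inter> G)"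
    by (rule arg_cong)
  also have "card (\<Union>p \<in> positions n. triangle_sides n (fst p) (snd p) \<inter> G) =
      (\<Sum>p \<in> positions n. card (triangle_sides n (fst p) (snd p) \<inter> G))"
  proof (rule card_UN_disjoint)
    show "\<forall>p\<in>positions n. \<forall>q\<in>positions n. p \<noteq> q \<longrightarrow>
        triangle_sides n (fst p) (snd p) \<inter> G \<inter> (triangle_sides n (fst q) (snd q) \<inter> G) = {}"
      using triangle_sides_disjoint unfolding prod_eq_iff by blast
  qed (auto simp: finite_positions triangle_sides_def Let_def)
  finally show ?thesis by (simp add: case_prod_unfold)
qed

section \<open>Components of a grove and its boundary sets\<close>

lemma boundary_sets_nonempty: "S \<in> boundary_sets n \<Longrightarrow> S \<noteq> {}"
  by (auto simp: boundary_sets_def west_pairs_def east_pairs_def south_pairs_def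
      middle_triplet_def split: if_splits)

text \<open>Connectivity makes the map from a component to the unique boundary set inside it a
  bijection; it is onto because every boundary set lies in some component.\<close>

lemma card_components_grove:
  assumes "simplified_grove n G"
  shows "card (components (grove_vertices n) G) = card (boundary_sets n)"
proof -
  let ?K = "components (grove_vertices n) G"
  have ex1: "\<exists>!S. S \<in> boundary_sets n \<and> S \<subseteq> C" if "C \<in> ?K" for C
    using assms that unfolding simplified_grove_def by (elim conjE) (rule bspec)
  have ex: "\<exists>C\<in>?K. S \<subseteq> C" if "S \<in> boundary_sets n" for S
    using assms that unfolding simplified_grove_def by (elim conjE) (rule bspec)
  have disj: "C = D" if "C \<in> ?K" "D \<in> ?K" "x \<in> C" "x \<in> D" for C D x
  proof -
    \<comment> \<open>The closure is an equivalence on the whole vertex type, so components are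
      regarded as classes there to obtain disjointness.\<close>
    have "?K \<subseteq> UNIV // {(u, v). {u, v} \<in> G}\<^sup>*" unfolding components_def quotient_def by auto
    then show ?thesis using that quotient_disj[OF equiv_connected[of G]] by blast
  qed
  define f where "f C = (THE S. S \<in> boundary_sets n \<and> S \<subseteq> C)" for C
  have f: "f C \<in> boundary_sets n" "f C \<subseteq> C" if "C \<in> ?K" for C
    using theI'[OF ex1[OF that]] unfolding f_def by auto
  have "bij_betw f ?K (boundary_sets n)"
    unfolding bij_betw_def
  proof
    show "inj_on f ?K"
    proof
      fix C D assume CD: "C \<in> ?K" "D \<in> ?K" "f C = f D"
      \<comment> \<open>Two components with the same boundary set share a point of it and therefore
        coincide.\<close>
      obtain x where "x \<in> f C" using boundary_sets_nonempty f(1) CD(1) by blast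
      then show "C = D" using f(2) CD disj by blast
    qed
    show "f ` ?K = boundary_sets n"
    proof
      show "boundary_sets n \<subseteq> f ` ?K"
      proof
        fix S assume S: "S \<in> boundary_sets n"
        then obtain C where C: "C \<in> ?K" "S \<subseteq> C" using ex by blast
        then have "f C = S" unfolding f_def using ex1[OF C(1)] S by (intro the1_equality) auto
        then show "S \<in> f ` ?K" using C(1) by blast
      qed
    qed (use f in blast)
  qed
  then show ?thesis by (rule bij_betw_same_card)
qed

text \<open>The right-hand side does not mention \<open>G\<close>, so any two groves of size
  \<open>n\<close> have arrays with the same entry sum.\<close>

lemma sum_grove_array:
  assumes "simplified_grove n G"
  shows "(\<Sum>(r, c) \<in> positions n. grove_array n G r c) =
    int (card (positions n)) + int (card (boundary_sets n)) - int (card (grove_vertices n))"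
proof -
  have G: "G \<subseteq> lattice_edges n" "\<nexists>vs. is_cycle G vs"
    using assms
    unfolding simplified_grove_def by auto
  have "finite G" using G(1) finite_lattice_edges finite_subset by blast
  then have "card G + card (components (grove_vertices n) G) = card (grove_vertices n)"
    by (rule card_edges_plus_card_components[OF finite_grove_vertices])
      (use lattice_edge_endpoints G in blast)+
  then have "card G + card (boundary_sets n) = card (grove_vertices n)"
    by (simp only: card_components_grove[OF assms])
  moreover have "(\<Sum>(r, c) \<in> positions n. grove_array n G r c) =
      (\<Sum>(r, c) \<in> positions n. 1 - int (card (triangle_sides n r c \<inter> G)))"
    by (rule sum.cong) (auto simp: grove_array_def positions_def)
  moreover have "\<dots> = int (card (positions n)) -
      int (\<Sum>(r, c) \<in> positions n. card (triangle_sides n r c \<inter> G))"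
    by (simp add: case_prod_unfold sum_subtractf)
  ultimately show ?thesis using sum_card_triangle_sides[OF G(1)] by simp
qed

subsection \<open>Arrays generated by the patterns\<close>

text \<open>Since a pattern step puts no condition on the arrays, the starting array can be
  arbitrary. This makes the attainable differences a subgroup of all arrays.\<close>

definition attainable :: "nat \<Rightarrow> array \<Rightarrow> bool" where
  "attainable n D \<longleftrightarrow> (\<forall>A. (pattern_step n)\<^sup>*\<^sup>* A (\<lambda>r c. A r c + D r c))"

lemma attainable_zero: "attainable n (\<lambda>r c. 0)"
  by (simp add: attainable_def)

lemma attainable_add:
  assumes "attainable n D" "attainable n D'"
  shows "attainable n (\<lambda>r c. D r c + D' r c)"
  unfolding attainable_def
proof
  fix A :: array
  have 1: "(pattern_step n)\<^sup>*\<^sup>* A (\<lambda>r c. A r c + D r c)"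
    using assms(1) unfolding attainable_def by (rule spec)
  have 2: "(pattern_step n)\<^sup>*\<^sup>* (\<lambda>r c. A r c + D r c) (\<lambda>r c. (A r c + D r c) + D' r c)"
    using assms(2) unfolding attainable_def by (rule spec)
  show "(pattern_step n)\<^sup>*\<^sup>* A (\<lambda>r c. A r c + (D r c + D' r c))"
    using rtranclp_trans[OF 1 2] by (simp only: add.assoc)
qed

text \<open>Adding and subtracting a pattern undo each other, so the sequence leading from
  \<open>A - D\<close> to \<open>A\<close> can be run backwards.\<close>

lemma attainable_uminus:
  assumes "attainable n D"
  shows "attainable n (\<lambda>r c. - D r c)"
  unfolding attainable_def
proof
  fix A :: array
  have "symp (pattern_step n)"
  proof (rule sympI)
    fix A B assume "pattern_step n A B"
    then obtain r c P where *: "1 \<le> r" "r \<le> n - 1" "1 \<le> c" "c \<le> n - r"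
      "P \<in> {pattern1 r c, pattern2 r c, pattern3 r c}"
      "B = (\<lambda>r' c'. A r' c' + P r' c') \<or> B = (\<lambda>r' c'. A r' c' - P r' c')"
      unfolding pattern_step_def by blast
    from *(6) have "A = (\<lambda>r' c'. B r' c' + P r' c') \<or> A = (\<lambda>r' c'. B r' c' - P r' c')" by auto
    with *(1-5) show "pattern_step n B A" unfolding pattern_step_def by blast
  qed
  then have "symp (pattern_step n)\<^sup>*\<^sup>*" by (rule symp_rtranclp)
  moreover have "(pattern_step n)\<^sup>*\<^sup>* (\<lambda>r c. A r c + - D r c) (\<lambda>r c. (A r c + - D r c) + D r c)"
    using assms unfolding attainable_def by (rule spec)
  ultimately show "(pattern_step n)\<^sup>*\<^sup>* A (\<lambda>r c. A r c + - D r c)" by (simp add: sympD)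
qed

lemma attainable_scale:
  assumes "attainable n D"
  shows "attainable n (\<lambda>r c. k * D r c)"
proof -
  have nat: "attainable n (\<lambda>r c. int m * D r c)" for m
    by (induction m) (auto simp: attainable_zero algebra_simps intro: attainable_add assms)
  show ?thesis
  proof (cases k)
    case (nonneg m)
    then show ?thesis using nat by simp
  next
    case (neg m)
    then have "(\<lambda>r c. k * D r c) = (\<lambda>r c. - (int (Suc m) * D r c))"
      by (simp only: mult_minus_left)
    then show ?thesis using attainable_uminus[OF nat[of "Suc m"]] by (simp only:)
  qed
qed

lemma attainable_sum:
  assumes "finite I" "\<And>i. i \<in> I \<Longrightarrow> attainable n (D i)"
  shows "attainable n (\<lambda>r c. \<Sum>i\<in>I. D i r c)"
  using assms by (induction I rule: finite_induct) (auto intro: attainable_zero attainable_add)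

section \<open>Moving a unit between entries\<close>

definition unit_array :: "nat \<Rightarrow> nat \<Rightarrow> array" where
  "unit_array r c = (\<lambda>r' c'. if r' = r \<and> c' = c then 1 else 0)"

lemma attainable_pattern:
  assumes "1 \<le> r" "r \<le> n - 1" "1 \<le> c" "c \<le> n - r"
    and "P \<in> {pattern1 r c, pattern2 r c, pattern3 r c}"
  shows "attainable n P"
  using assms unfolding attainable_def pattern_step_def by blast

lemma attainable_right:
  assumes "(r, c) \<in> positions n" "(r, Suc c) \<in> positions n"
  shows "attainable n (\<lambda>r' c'. unit_array r (Suc c) r' c' - unit_array r c r' c')"
proof -
  have "(\<lambda>r' c'. unit_array r (Suc c) r' c' - unit_array r c r' c') = pattern1 r c"
    by (auto simp: fun_eq_iff unit_array_def pattern1_def sub_triangle_def)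
  moreover have "attainable n (pattern1 r c)"
    by (rule attainable_pattern[of r n c]) (use assms in \<open>auto simp: positions_def\<close>)
  ultimately show ?thesis by simp
qed

lemma attainable_down:
  assumes "(Suc r, c) \<in> positions n" "1 \<le> r"
  shows "attainable n (\<lambda>r' c'. unit_array (Suc r) c r' c' - unit_array r c r' c')"
proof -
  have "(\<lambda>r' c'. unit_array (Suc r) c r' c' - unit_array r c r' c') =
      (\<lambda>r' c'. - pattern2 r c r' c')"
    by (auto simp: fun_eq_iff unit_array_def pattern2_def sub_triangle_def)
  moreover have "attainable n (pattern2 r c)"
    by (rule attainable_pattern[of r n c]) (use assms in \<open>auto simp: positions_def\<close>)
  ultimately show ?thesis using attainable_uminus by simp
qed

text \<open>The differences telescope along a path from \<open>(1, 1)\<close> rightward in row 1 to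
  column \<open>c\<close> and then down that column. The path stays inside the triangle, as
  decreasing an index does not leave it.\<close>

lemma attainable_unit_difference:
  assumes "(r, c) \<in> positions n"
  shows "attainable n (\<lambda>r' c'. unit_array r c r' c' - unit_array 1 1 r' c')"
proof -
  have "1 \<le> r" "1 \<le> c" using assms by (auto simp: positions_def)
  from \<open>1 \<le> r\<close> assms show ?thesis
  proof (induction r rule: dec_induct)
    case base
    from \<open>1 \<le> c\<close> base show ?case
    proof (induction c rule: dec_induct)
      case base
      show ?case by (simp add: attainable_zero)
    next
      case (step c)
      then have pos: "(1, c) \<in> positions n" by (auto simp: positions_def)
      show ?case
        using attainable_add[OF step.IH[OF pos] attainable_right[OF pos step.prems]] by simp
    qed
  next
    case (step r)
    then have pos: "(r, c) \<in> positions n" by (auto simp: positions_def)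
    show ?case
      using attainable_add[OF step.IH[OF pos] attainable_down[OF step.prems step.hyps(1)]] by simp
  qed
qed

text \<open>Expanding \<open>D\<close> in unit arrays, each corrected by the unit at
  \<open>(1, 1)\<close>, changes it only by its entry sum times that unit, which is zero.\<close>

lemma attainable_if_sum_zero:
  assumes supp: "\<And>r c. (r, c) \<notin> positions n \<Longrightarrow> D r c = 0"
    and sum: "(\<Sum>(r, c) \<in> positions n. D r c) = 0"
  shows "attainable n D"
proof -
  have "D r' c' = (\<Sum>(r, c) \<in> positions n.
      D r c * (unit_array r c r' c' - unit_array 1 1 r' c'))" for r' c'
  proof -
    have "(\<Sum>(r, c) \<in> positions n. D r c * (unit_array r c r' c' - unit_array 1 1 r' c')) =
        (\<Sum>(r, c) \<in> positions n. D r c * unit_array r c r' c') -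
        (\<Sum>(r, c) \<in> positions n. D r c) * unit_array 1 1 r' c'"
      by (simp only: case_prod_unfold right_diff_distrib sum_subtractf sum_distrib_right)
    also have "\<dots> = (\<Sum>p \<in> positions n. if p = (r', c') then D r' c' else 0)"
    proof -
      have "(\<Sum>(r, c) \<in> positions n. D r c * unit_array r c r' c') =
          (\<Sum>p \<in> positions n. if p = (r', c') then D r' c' else 0)"
        by (rule sum.cong) (auto simp: unit_array_def split: if_splits)
      then show ?thesis unfolding sum by (simp only: mult_zero_left diff_zero)
    qed
    \<comment> \<open>Outside \<open>positions n\<close> no summand matches, and \<open>supp\<close>
      makes \<open>D r' c'\<close> zero as well.\<close>
    also have "\<dots> = D r' c'"
      using supp[of r' c'] by (simp add: sum.delta[OF finite_positions])
    finally show ?thesis by (rule sym)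
  qed
  then have eq: "D = (\<lambda>r' c'. \<Sum>p \<in> positions n. D (fst p) (snd p) *
      (unit_array (fst p) (snd p) r' c' - unit_array 1 1 r' c'))"
    unfolding case_prod_unfold by (intro ext)
  have "attainable n (\<lambda>r' c'. \<Sum>p \<in> positions n. D (fst p) (snd p) *
      (unit_array (fst p) (snd p) r' c' - unit_array 1 1 r' c'))"
    by (intro attainable_sum attainable_scale attainable_unit_difference)
      (auto simp: finite_positions)
  then show ?thesis by (subst eq)
qed

theorem theorem2:
  fixes n :: nat and A1 A2 :: array
  assumes "n \<ge> 1"
    and "alternating_sign_triangle n A1"
    and "alternating_sign_triangle n A2"
  shows "(pattern_step n)\<^sup>*\<^sup>* A2 A1"
proof -
  obtain G1 G2 where G: "simplified_grove n G1" "A1 = grove_array n G1"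
    "simplified_grove n G2" "A2 = grove_array n G2"
    using assms unfolding alternating_sign_triangle_def by blast
  have "attainable n (\<lambda>r c. A1 r c - A2 r c)"
  proof (rule attainable_if_sum_zero)
    show "(\<Sum>(r, c) \<in> positions n. A1 r c - A2 r c) = 0"
      using sum_grove_array[OF G(1)] sum_grove_array[OF G(3)] G(2,4)
      by (simp add: case_prod_unfold sum_subtractf)
  \<comment> \<open>Both arrays are 0 outside the triangle by definition, hence so is their
    difference.\<close>
  qed (auto simp: G grove_array_def positions_def)
  then have "(pattern_step n)\<^sup>*\<^sup>* A2 (\<lambda>r c. A2 r c + (A1 r c - A2 r c))"
    unfolding attainable_def by (rule spec)
  then show ?thesis by simp
qed

end
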